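(* Let $\mathbb F_q$ be a finite field of characteristic three, and let $\sigma\in\mathbb F_q$ be a nonsquare. Then any cubic rational expression $R(x)$ over $\mathbb F_q$ with at most three ramification points in $\mathbb P^1(\overline{\mathbb F}_q)$ is equivalent over $\mathbb F_q$ to either $x^3+x^2$, or $x^3+x$, or $x^3+\sigma x$.
   Context: A rational expression $R(x)=g(x)/h(x)$ with $g,h$ coprime has degree $\max(\deg g,\deg h)$; cubic means degree $3$. The group $G(\mathbb F_q)=\mathrm{PGL}_2(\mathbb F_q)\times\mathrm{PGL}_2(\mathbb F_q)$, with $\mathrm{PGL}_2(\mathbb F_q)$ identified with the group of degree-one rational expressions (Möbius transformations) over $\mathbb F_q$ under composition, acts on $\mathbb F_q(x)$ by $(B,A)\cdot R(x)=B(R(A^{-1}(x)))$; two expressions are equivalent over $\mathbb F_q$ if they lie in the same $G(\mathbb F_q)$-orbit. Viewing $R$ as a map $\mathbb P^1(\overline{\mathbb F}_q)\to\mathbb P^1(\overline{\mathbb F}_q)$, a ramification point is a point $P$ whose ramification index $e_R(P)$ (multiplicity of $P$ in the fibre $R^{-1}(R(P))$) exceeds $1$. *)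

theory Defs
  imports
    "HOL-Algebra.Algebraic_Closure_Type"
    "HOL-Algebra.Group_Action"
begin

text \<open>
  The field of rational expressions over \<open>'a\<close> is \<open>'a poly fract\<close>. The library function
  \<open>quot_of_fract\<close> would need \<open>'a\<close> to be of class \<open>field_gcd\<close>; the coprime representation with
  monic denominator is therefore defined here for an arbitrary field.
\<close>

definition rat_quot :: "'a::field poly fract \<Rightarrow> 'a poly \<times> 'a poly" where
  "rat_quot R = (THE (g, h). R = Fract g h \<and> coprime g h \<and> lead_coeff h = 1)"

definition rat_num :: "'a::field poly fract \<Rightarrow> 'a poly" where
  "rat_num R = fst (rat_quot R)"

definition rat_denom :: "'a::field poly fract \<Rightarrow> 'a poly" where
  "rat_denom R = snd (rat_quot R)"

lemma Fract_coprime_monic_exists: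
  fixes g h :: "'a::field poly"
  assumes "h \<noteq> 0"
  shows "\<exists>g' h'. Fract g h = Fract g' h' \<and> coprime g' h' \<and> lead_coeff h' = 1"
  using assms
proof (induction "degree h" arbitrary: g h rule: less_induct)
  case less
  show ?case
  proof (cases "coprime g h")
    case True
    define c where "c = inverse (lead_coeff h)"
    have c: "c \<noteq> 0" using less.prems by (simp add: c_def)
    have "Fract g h = Fract (smult c g) (smult c h)"
      using less.prems c by (simp add: eq_fract)
    moreover have "coprime (smult c g) (smult c h)"
    proof (rule coprimeI)
      fix d assume "d dvd smult c g" "d dvd smult c h"
      hence "d dvd g" "d dvd h" using c by (simp_all add: dvd_smult_iff)
      thus "is_unit d" using True by (auto intro: coprime_common_divisor)
    qed
    moreover have "lead_coeff (smult c h) = 1"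
      using less.prems by (simp add: c_def)
    ultimately show ?thesis by blast
  next
    case False
    then obtain d where d: "d dvd g" "d dvd h" "\<not> is_unit d"
      by (auto simp: coprime_def)
    obtain g1 h1 where e: "g = d * g1" "h = d * h1"
      using d by (auto elim!: dvdE)
    have nz: "d \<noteq> 0" "h1 \<noteq> 0" using e less.prems by auto
    have "degree d > 0" using d(3) nz by (simp add: is_unit_iff_degree)
    moreover have "degree h = degree d + degree h1"
      unfolding e(2) by (rule degree_mult_eq[OF nz])
    ultimately have "degree h1 < degree h" by linarith
    from less.hyps[OF this nz(2), of g1]
    obtain g' h' where "Fract g1 h1 = Fract g' h'" "coprime g' h'" "lead_coeff h' = 1" by blast
    moreover have "Fract g h = Fract g1 h1"
      using nz unfolding e by (subst eq_fract) (simp_all add: mult_ac)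
    ultimately show ?thesis by auto
  qed
qed

lemma coprime_bezout_poly:
  fixes g h :: "'a::field poly"
  assumes "coprime g h"
  shows "\<exists>s t. s * g + t * h = 1"
  using assms
proof (induction "if h = 0 then 0 else Suc (degree h)" arbitrary: g h rule: less_induct)
  case less
  show ?case
  proof (cases "h = 0")
    case True
    hence "g dvd 1" using less.prems by simp
    then obtain s where "1 = g * s" by (rule dvdE)
    thus ?thesis by (metis add.right_neutral mult.commute mult_zero_left)
  next
    case False
    have "coprime h (g mod h)"
    proof (rule coprimeI)
      fix d assume "d dvd h" "d dvd g mod h"
      moreover from this have "d dvd g" by (simp add: dvd_mod_iff)
      ultimately show "is_unit d" using less.prems by (auto intro: coprime_common_divisor)
    qed
    moreover have "(if g mod h = 0 then 0 else Suc (degree (g mod h)))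
        < (if h = 0 then 0 else Suc (degree h))"
      using False degree_mod_less[OF False, of g] by auto
    ultimately obtain s t where st: "s * h + t * (g mod h) = 1"
      using less.hyps by blast
    have "g mod h = g - g div h * h" by (rule minus_div_mult_eq_mod[symmetric])
    with st have "s * h + t * (g - g div h * h) = 1" by simp
    hence "t * g + (s - t * (g div h)) * h = 1" by (simp only: algebra_simps)
    thus ?thesis by blast
  qed
qed

lemma coprime_dvd_mult_poly:
  fixes g h k :: "'a::field poly"
  assumes "coprime g h" "g dvd h * k"
  shows "g dvd k"
proof -
  obtain s t where st: "s * g + t * h = 1" using coprime_bezout_poly[OF assms(1)] by blast
  have "k = (s * g + t * h) * k" by (simp add: st)
  also have "\<dots> = g * (s * k) + (h * k) * t" by (simp add: algebra_simps)
  finally have "k = g * (s * k) + (h * k) * t" .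
  moreover have "g dvd g * (s * k) + (h * k) * t"
    by (rule dvd_add[OF dvd_triv_left dvd_mult2[OF assms(2)]])
  ultimately show ?thesis by simp
qed

lemma Fract_coprime_monic_unique:
  fixes g h g' h' :: "'a::field poly"
  assumes "Fract g h = Fract g' h'" "coprime g h" "coprime g' h'"
    and lc: "lead_coeff h = 1" "lead_coeff h' = 1"
  shows "g = g' \<and> h = h'"
proof -
  have nz: "h \<noteq> 0" "h' \<noteq> 0" using lc by auto
  have eq: "g * h' = g' * h" using assms(1) nz by (simp add: eq_fract)
  have 1: "h dvd h'"
    using eq assms(2) by (intro coprime_dvd_mult_poly[of h g h']) (auto simp: coprime_commute)
  have 2: "h' dvd h"
    using eq[symmetric] assms(3)
    by (intro coprime_dvd_mult_poly[of h' g' h]) (auto simp: coprime_commute)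
  obtain u where u: "h' = h * u" using 1 by (rule dvdE)
  have "degree h = degree h'" using 1 2 nz by (intro antisym dvd_imp_degree_le)
  moreover have "u \<noteq> 0" using u nz by auto
  ultimately have "degree u = 0" using nz degree_mult_eq[of h u] u by simp
  then obtain c where c: "u = [:c:]" by (rule degree_eq_zeroE)
  have "lead_coeff h' = lead_coeff h * c" unfolding u c lead_coeff_mult by simp
  hence "c = 1" using lc by simp
  hence "h = h'" using u c by simp
  with eq nz show ?thesis by simp
qed

lemma rat_quot_props:
  "R = Fract (rat_num R) (rat_denom R)" "coprime (rat_num R) (rat_denom R)"
  "lead_coeff (rat_denom R) = 1"
proof -
  obtain g0 h0 where "R = Fract g0 h0" "h0 \<noteq> 0" by (cases R)
  then obtain g h where gh: "R = Fract g h" "coprime g h" "lead_coeff h = 1"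
    using Fract_coprime_monic_exists[of h0 g0] by auto
  have "rat_quot R = (g, h)" unfolding rat_quot_def
  proof (rule the_equality)
    show "case (g, h) of (g, h) \<Rightarrow> R = Fract g h \<and> coprime g h \<and> lead_coeff h = 1"
      using gh by simp
  next
    fix p assume p: "case p of (g, h) \<Rightarrow> R = Fract g h \<and> coprime g h \<and> lead_coeff h = 1"
    obtain g' h' where p_eq: "p = (g', h')" by (cases p)
    have p': "R = Fract g' h'" "coprime g' h'" "lead_coeff h' = 1"
      using p unfolding p_eq prod.case by blast+
    have "g' = g \<and> h' = h"
      by (rule Fract_coprime_monic_unique[OF _ p'(2) gh(2) p'(3) gh(3)])
         (rule trans[OF p'(1)[symmetric] gh(1)])
    thus "p = (g, h)" by (simp only: p_eq)
  qed
  hence eq: "rat_num R = g" "rat_denom R = h"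
    by (simp_all only: rat_num_def rat_denom_def fst_conv snd_conv)
  show "R = Fract (rat_num R) (rat_denom R)" "coprime (rat_num R) (rat_denom R)"
    "lead_coeff (rat_denom R) = 1"
    unfolding eq by (rule gh)+
qed

definition rat_degree :: "'a::field poly fract \<Rightarrow> nat" where
  "rat_degree R = max (degree (rat_num R)) (degree (rat_denom R))"

definition rat_X :: "'a::field poly fract" where
  "rat_X = to_fract [:0, 1:]"

definition rat_const :: "'a::field \<Rightarrow> 'a poly fract" where
  "rat_const c = to_fract [:c:]"

text \<open>
  \<open>rat_comp S R\<close> is \<open>S(R(x))\<close>. It is meaningful for nonconstant \<open>R\<close>, where the denominator of \<open>S\<close>
  does not vanish at \<open>R\<close>.
\<close>

definition rat_comp :: "'a::field poly fract \<Rightarrow> 'a poly fract \<Rightarrow> 'a poly fract" where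
  "rat_comp S R =
     poly (map_poly rat_const (rat_num S)) R / poly (map_poly rat_const (rat_denom S)) R"

definition PGL2 :: "'a::field poly fract monoid" where
  "PGL2 = \<lparr>carrier = {A. rat_degree A = 1}, monoid.mult = rat_comp, one = rat_X\<rparr>"

definition PGL2_action ::
    "'a::field poly fract \<times> 'a poly fract \<Rightarrow> 'a poly fract \<Rightarrow> 'a poly fract" where
  "PGL2_action = (\<lambda>(B, A) R. rat_comp B (rat_comp R (inv\<^bsub>PGL2\<^esub> A)))"

definition rat_equivalent :: "'a::field poly fract \<Rightarrow> 'a poly fract \<Rightarrow> bool" where
  "rat_equivalent R S \<longleftrightarrow> S \<in> orbit (PGL2 \<times>\<times> PGL2) PGL2_action R"

text \<open>
  The projective line over the algebraic closure is \<open>'a alg_closure option\<close>, with \<open>None\<close> the point at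
  infinity. The fibre of \<open>R = g / h\<close> over a finite point \<open>c\<close> is cut out by \<open>g - c h\<close>, the fibre over
  infinity by \<open>h\<close>. As forms of degree \<open>deg R\<close>, these vanish at infinity to the order \<open>deg R\<close> minus
  their degree as polynomials in \<open>x\<close>.
\<close>

definition rat_num_ac :: "'a::field poly fract \<Rightarrow> 'a alg_closure poly" where
  "rat_num_ac R = map_poly to_ac (rat_num R)"

definition rat_denom_ac :: "'a::field poly fract \<Rightarrow> 'a alg_closure poly" where
  "rat_denom_ac R = map_poly to_ac (rat_denom R)"

fun rat_map :: "'a::field poly fract \<Rightarrow> 'a alg_closure option \<Rightarrow> 'a alg_closure option" where
  "rat_map R (Some a) =
     (if poly (rat_denom_ac R) a = 0 then None
      else Some (poly (rat_num_ac R) a / poly (rat_denom_ac R) a))"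
| "rat_map R None =
     (let d = rat_degree R in
      if Polynomial.coeff (rat_denom_ac R) d = 0 then None
      else Some (Polynomial.coeff (rat_num_ac R) d / Polynomial.coeff (rat_denom_ac R) d))"

fun fibre_poly :: "'a::field poly fract \<Rightarrow> 'a alg_closure option \<Rightarrow> 'a alg_closure poly" where
  "fibre_poly R (Some c) = rat_num_ac R - Polynomial.smult c (rat_denom_ac R)"
| "fibre_poly R None = rat_denom_ac R"

fun fibre_mult :: "'a::field poly fract \<Rightarrow> 'a alg_closure option \<Rightarrow> 'a alg_closure option \<Rightarrow> nat" where
  "fibre_mult R Q (Some a) = Polynomial.order a (fibre_poly R Q)"
| "fibre_mult R Q None = rat_degree R - Polynomial.degree (fibre_poly R Q)"

definition ramification_index :: "'a::field poly fract \<Rightarrow> 'a alg_closure option \<Rightarrow> nat" where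
  "ramification_index R P = fibre_mult R (rat_map R P) P"

definition ramification_points :: "'a::field poly fract \<Rightarrow> 'a alg_closure option set" where
  "ramification_points R = {P. ramification_index R P > 1}"

end

theory Submission
  imports Defs
begin

text \<open>
  Write \<open>R = g / h\<close> with coefficients \<open>a\<^sub>i\<close>, \<open>b\<^sub>i\<close>. The ramification points are the zeros of the
  Wronskian \<open>W = g' h - g h'\<close>, read as a form of degree 4. In characteristic three its middle
  coefficient is \<open>a\<^sub>2 b\<^sub>1 - a\<^sub>1 b\<^sub>2\<close>, and this vanishes as soon as \<open>W\<close> has a multiple zero. Hence at most
  three ramification points force \<open>a\<^sub>1 b\<^sub>2 = a\<^sub>2 b\<^sub>1\<close>, so some combination of \<open>g\<close> and \<open>h\<close>
  over the ground field is \<open>c\<^sub>3 x\<^sup>3 + c\<^sub>0\<close>. Since cubing is bijective on a finite field of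
  characteristic three, this combination is a constant or has a rational triple zero, and no Galois
  descent is needed to find the rational point of index 3. Moving that point and its image to
  infinity turns \<open>R\<close> into a cubic polynomial, which affine substitutions bring to normal form.
\<close>

subsection \<open>Moebius transformations\<close>

lemma rat_const_0 [simp]: "rat_const 0 = 0"
  and rat_const_1 [simp]: "rat_const 1 = 1"
  and rat_const_add [simp]: "rat_const (a + b) = rat_const a + rat_const b"
  and rat_const_diff [simp]: "rat_const (a - b) = rat_const a - rat_const b"
  and rat_const_minus [simp]: "rat_const (- a) = - rat_const a"
  and rat_const_mult [simp]: "rat_const (a * b) = rat_const a * rat_const b"
  by (simp_all add: rat_const_def flip: to_fract_add to_fract_diff to_fract_uminus to_fract_mult one_pCons)

lemma rat_const_numeral [simp]: "rat_const (numeral n) = numeral n"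
proof -
  have "rat_const (of_nat k) = of_nat k" for k by (induction k) simp_all
  from this[of "numeral n"] show ?thesis by simp
qed

lemma rat_const_power [simp]: "rat_const (a ^ n) = rat_const a ^ n"
  by (induction n) simp_all

lemma rat_const_eq_iff [simp]: "rat_const a = rat_const b \<longleftrightarrow> a = b"
  by (simp add: rat_const_def)

lemma rat_const_eq_0_iff [simp]: "rat_const a = 0 \<longleftrightarrow> a = 0"
  using rat_const_eq_iff[of a 0] by simp

lemma rat_const_divide [simp]: "rat_const (a / b) = rat_const a / rat_const b"
proof (cases "b = 0")
  case False
  hence "rat_const (a / b) * rat_const b = rat_const a"
    by (simp flip: rat_const_mult)
  thus ?thesis using False by (simp add: field_simps)
qed simp

lemma to_fract_pCons: "to_fract (pCons a p) = rat_const a + rat_X * to_fract p"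
proof -
  have "pCons a p = [:a:] + [:0, 1:] * p" by simp
  thus ?thesis unfolding rat_const_def rat_X_def by (metis to_fract_add to_fract_mult)
qed

lemma linear_rat_X_neq_0:
  assumes "a \<noteq> 0 \<or> b \<noteq> 0"
  shows "rat_const a * rat_X + rat_const b \<noteq> 0"
proof -
  have "to_fract [:b, a:] = rat_const a * rat_X + rat_const b"
    by (simp add: to_fract_pCons)
  thus ?thesis using assms by (metis pCons_eq_0_iff to_fract_eq_0_iff)
qed

text \<open>The four matrix entries stay as parameters, so that inversion becomes the adjugate; the
  determinant condition is imposed where it matters.\<close>

definition moebius :: "'a::field \<Rightarrow> 'a \<Rightarrow> 'a \<Rightarrow> 'a \<Rightarrow> 'a poly fract" where
  "moebius a b c d = Fract [:b, a:] [:d, c:]"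

lemma moebius_conv:
  assumes "c \<noteq> 0 \<or> d \<noteq> 0"
  shows "moebius a b c d = (rat_const a * rat_X + rat_const b) / (rat_const c * rat_X + rat_const d)"
proof -
  have "moebius a b c d = to_fract [:b, a:] / to_fract [:d, c:]"
    using assms by (simp add: moebius_def to_fract_def)
  thus ?thesis by (simp add: to_fract_pCons algebra_simps)
qed

lemma moebius_quot:
  fixes a b c d :: "'a::field"
  assumes det: "a * d - b * c \<noteq> 0"
  obtains k where "k \<noteq> 0" "rat_num (moebius a b c d) = smult k [:b, a:]"
    "rat_denom (moebius a b c d) = smult k [:d, c:]"
proof -
  \<comment> \<open>The reciprocal of the leading coefficient of the denominator, which is
    \<open>d\<close> when \<open>c = 0\<close>, so scaling by \<open>k\<close> makes it
    monic.\<close>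
  define k where "k = (if c = 0 then 1 / d else 1 / c)"
  have k: "k \<noteq> 0" using det by (auto simp: k_def)
  have cop: "coprime (smult k [:b, a:]) (smult k [:d, c:])"
  proof (rule coprimeI)
    fix p assume "p dvd smult k [:b, a:]" "p dvd smult k [:d, c:]"
    hence *: "p dvd [:b, a:]" "p dvd [:d, c:]" using k by (simp_all only: dvd_smult_iff simp_thms)
    \<comment> \<open>This combination eliminates the variable and leaves the determinant, a
      unit.\<close>
    have "p dvd smult a [:d, c:] - smult c [:b, a:]"
      by (intro dvd_diff dvd_smult *)
    also have "\<dots> = [:a * d - b * c:]" by (simp add: mult.commute)
    finally show "is_unit p" using det
      by (metis dvd_trans is_unit_triv)
  qed
  have lc: "lead_coeff (smult k [:d, c:]) = 1" using det by (auto simp: k_def)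
  have "moebius a b c d = Fract (smult k [:b, a:]) (smult k [:d, c:])"
    unfolding moebius_def using det k by (subst eq_fract) (auto simp: mult_ac)
  hence "rat_num (moebius a b c d) = smult k [:b, a:] \<and> rat_denom (moebius a b c d) = smult k [:d, c:]"
    by (intro Fract_coprime_monic_unique[OF _ rat_quot_props(2) cop rat_quot_props(3) lc])
       (metis rat_quot_props(1))
  thus ?thesis using that k by blast
qed

lemma rat_degree_moebius:
  assumes "a * d - b * c \<noteq> 0"
  shows "rat_degree (moebius a b c d) = 1"
  by (rule moebius_quot[OF assms]) (use assms in \<open>auto simp: rat_degree_def\<close>)

lemma rat_comp_moebius:
  assumes "a * d - b * c \<noteq> 0"
  shows "rat_comp (moebius a b c d) T = (rat_const a * T + rat_const b) / (rat_const c * T + rat_const d)"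
proof -
  obtain k where k: "k \<noteq> 0" "rat_num (moebius a b c d) = smult k [:b, a:]"
    "rat_denom (moebius a b c d) = smult k [:d, c:]"
    by (rule moebius_quot[OF assms])
  have "rat_comp (moebius a b c d) T =
      (rat_const k * (rat_const a * T + rat_const b)) / (rat_const k * (rat_const c * T + rat_const d))"
    by (simp add: rat_comp_def k(2,3) map_poly_pCons algebra_simps)
  thus ?thesis using k(1) by simp
qed

lemma rat_comp_moebius_divide:
  assumes "a * d - b * c \<noteq> 0" "v \<noteq> 0"
  shows "rat_comp (moebius a b c d) (u / v) =
    (rat_const a * u + rat_const b * v) / (rat_const c * u + rat_const d * v)"
proof -
  have "rat_const s * (u / v) + rat_const t = (rat_const s * u + rat_const t * v) / v" for s t
    using assms(2) by (simp add: field_simps)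
  thus ?thesis using assms(2) by (simp add: rat_comp_moebius[OF assms(1)])
qed

text \<open>The adjugate matrix inverts up to the scalar \<open>D\<close>, which cancels in the
  quotient. The inverse is a definite description and \<open>PGL2\<close> is not shown to be a group
  here, so uniqueness is checked directly.\<close>

lemma inv_PGL2_moebius:
  fixes a b c d :: "'a::field"
  assumes det: "a * d - b * c \<noteq> 0"
  shows "inv\<^bsub>PGL2\<^esub> (moebius a b c d) = moebius d (- b) (- c) a"
proof -
  define D where "D = a * d - b * c"
  have det': "d * a - (- b) * (- c) \<noteq> 0" using det by (simp add: mult_ac)
  have ne: "rat_const (- c) * rat_X + rat_const a \<noteq> 0" "rat_const c * rat_X + rat_const d \<noteq> 0"
    using det by (intro linear_rat_X_neq_0; force)+
  define x where "x = (rat_X :: 'a poly fract)"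
  have D: "rat_const D \<noteq> 0" using det by (simp add: D_def del: rat_const_diff rat_const_mult)
  have 1: "rat_comp (moebius a b c d) (moebius d (- b) (- c) a) = rat_X"
  proof -
    have eqs: "rat_const a * (rat_const d * x - rat_const b) + rat_const b * (rat_const a - rat_const c * x)
        = rat_const D * x"
      "rat_const c * (rat_const d * x - rat_const b) + rat_const d * (rat_const a - rat_const c * x)
        = rat_const D" by (simp_all add: D_def algebra_simps)
    have ne': "rat_const a - rat_const c * x \<noteq> 0" using ne by (simp add: x_def)
    have "moebius d (- b) (- c) a = (rat_const d * x - rat_const b) / (rat_const a - rat_const c * x)"
      using det by (subst moebius_conv) (auto simp: x_def)
    hence "rat_comp (moebius a b c d) (moebius d (- b) (- c) a) = rat_const D * x / rat_const D"
      by (simp only: rat_comp_moebius_divide[OF det ne'] eqs)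
    thus ?thesis using D by (simp add: x_def)
  qed
  have 2: "rat_comp (moebius d (- b) (- c) a) (moebius a b c d) = rat_X"
  proof -
    have eqs: "rat_const d * (rat_const a * x + rat_const b) + rat_const (- b) * (rat_const c * x + rat_const d)
        = rat_const D * x"
      "rat_const (- c) * (rat_const a * x + rat_const b) + rat_const a * (rat_const c * x + rat_const d)
        = rat_const D" by (simp_all add: D_def algebra_simps)
    have ne': "rat_const c * x + rat_const d \<noteq> 0" using ne by (simp add: x_def)
    have "moebius a b c d = (rat_const a * x + rat_const b) / (rat_const c * x + rat_const d)"
      using det by (subst moebius_conv) (auto simp: x_def)
    hence "rat_comp (moebius d (- b) (- c) a) (moebius a b c d) = rat_const D * x / rat_const D"
      by (simp only: rat_comp_moebius_divide[OF det' ne'] eqs)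
    thus ?thesis using D by (simp add: x_def)
  qed
  have 3: "y = moebius d (- b) (- c) a"
    if y: "rat_comp (moebius a b c d) y = rat_X" for y
  proof -
    \<comment> \<open>A zero denominator would make the quotient 0 by convention, and
      \<open>rat_X\<close> is not 0. The equation can then be solved for \<open>y\<close>.\<close>
    have "rat_const c * y + rat_const d \<noteq> 0"
      using y unfolding rat_comp_moebius[OF det] by (auto simp: rat_X_def)
    hence "rat_const a * y + rat_const b = rat_X * (rat_const c * y + rat_const d)"
      using y unfolding rat_comp_moebius[OF det] by (simp add: field_simps)
    hence "y * (rat_const (- c) * rat_X + rat_const a) = rat_const d * rat_X + rat_const (- b)"
      by (simp add: algebra_simps)
    moreover have "moebius d (- b) (- c) a =
        (rat_const d * rat_X + rat_const (- b)) / (rat_const (- c) * rat_X + rat_const a)"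
      using det by (intro moebius_conv) auto
    ultimately show ?thesis using ne(1) by (metis nonzero_eq_divide_eq)
  qed
  have "m_inv PGL2 (moebius a b c d) = moebius d (- b) (- c) a"
    unfolding m_inv_def
  proof (rule the_equality)
    show "moebius d (- b) (- c) a \<in> carrier PGL2 \<and>
        moebius a b c d \<otimes>\<^bsub>PGL2\<^esub> moebius d (- b) (- c) a = \<one>\<^bsub>PGL2\<^esub> \<and>
        moebius d (- b) (- c) a \<otimes>\<^bsub>PGL2\<^esub> moebius a b c d = \<one>\<^bsub>PGL2\<^esub>"
      using 1 2 rat_degree_moebius[OF det'] by (simp only: PGL2_def monoid.simps partial_object.simps mem_Collect_eq simp_thms)
  next
    fix y assume "y \<in> carrier PGL2 \<and> moebius a b c d \<otimes>\<^bsub>PGL2\<^esub> y = \<one>\<^bsub>PGL2\<^esub> \<and>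
        y \<otimes>\<^bsub>PGL2\<^esub> moebius a b c d = \<one>\<^bsub>PGL2\<^esub>"
    hence "rat_comp (moebius a b c d) y = rat_X"
      by (simp only: PGL2_def monoid.simps partial_object.simps)
    thus "y = moebius d (- b) (- c) a" by (rule 3)
  qed
  thus ?thesis by simp
qed

text \<open>The equation \<open>eq\<close> is B(R(C)) = S with denominators cleared, for B with
  entries \<open>a\<close>, \<open>b\<close>, \<open>c\<close>, \<open>d\<close> and C with entries
  \<open>p\<close>, \<open>q\<close>, \<open>r\<close>, \<open>s\<close>. Nonconstancy of
  \<open>S\<close> rules out \<open>h = 0\<close>.\<close>

lemma rat_equivalentI:
  fixes R S :: "'a::field poly fract"
  assumes detC: "p * s - q * r \<noteq> 0" and detB: "a * d - b * c \<noteq> 0"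
    and S: "S \<notin> range rat_const"
    and gC: "g = poly (map_poly rat_const (rat_num R)) (moebius p q r s)"
    and hC: "h = poly (map_poly rat_const (rat_denom R)) (moebius p q r s)"
    and eq: "rat_const a * g + rat_const b * h = S * (rat_const c * g + rat_const d * h)"
    and ne: "rat_const c * g + rat_const d * h \<noteq> 0"
  shows "rat_equivalent R S"
proof -
  have h: "h \<noteq> 0"
  proof
    assume "h = 0"
    hence c: "rat_const c \<noteq> 0" and g: "g \<noteq> 0" and "rat_const a * g = S * rat_const c * g"
      using eq ne by auto
    hence "S = rat_const (a / c)" by (simp add: field_simps)
    thus False using S by blast
  qed
  have "rat_comp R (moebius p q r s) = g / h" by (simp add: rat_comp_def gC hC)
  hence S_eq: "rat_comp (moebius a b c d) (rat_comp R (moebius p q r s)) = S"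
    using h ne eq by (simp add: rat_comp_moebius_divide[OF detB])
  \<comment> \<open>The action substitutes the inverse of \<open>A\<close>, so \<open>A\<close> has
    to be the inverse of C.\<close>
  define A where "A = moebius s (- q) (- r) p"
  have detA: "s * p - (- q) * (- r) \<noteq> 0" using detC by (simp add: mult_ac)
  have "inv\<^bsub>PGL2\<^esub> A = moebius p q r s"
    using inv_PGL2_moebius[OF detA] by (simp add: A_def)
  hence "PGL2_action (moebius a b c d, A) R = S" using S_eq by (simp add: PGL2_action_def)
  moreover have "(moebius a b c d, A) \<in> carrier (PGL2 \<times>\<times> PGL2)"
    using rat_degree_moebius[OF detB] rat_degree_moebius[OF detA] by (simp add: PGL2_def A_def DirProd_def)
  ultimately show ?thesis unfolding rat_equivalent_def orbit_def by blast
qed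

subsection \<open>Roots of polynomials\<close>

text \<open>In a finite field the product of all X - a, increased by 1, is nonconstant and has no
  root.\<close>

lemma infinite_UNIV_alg_closed: "infinite (UNIV :: 'a::alg_closed_field set)"
proof
  assume fin: "finite (UNIV :: 'a set)"
  define p where "p = (\<Prod>a\<in>(UNIV::'a set). [:- a, 1:])"
  have "degree p = (\<Sum>a\<in>(UNIV::'a set). degree [:- a, 1:])"
    unfolding p_def by (rule degree_prod_sum_eq) auto
  also have "\<dots> = card (UNIV :: 'a set)" by simp
  finally have deg: "degree p > 0" using fin finite_UNIV_card_ge_0 by metis
  moreover have "degree (p + 1) = degree p" using deg by (intro degree_add_eq_left) simp
  ultimately obtain x where "poly (p + 1) x = 0"
    using alg_closed_imp_poly_has_root[of "p + 1"] by auto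
  moreover have "poly p x = 0" using fin by (auto simp: p_def poly_prod)
  ultimately show False by simp
qed

text \<open>Split off a root x as p = (X - x) q. Then p' = q + (X - x) q' shows that x is not a root
  of q and that the roots of q are again simple.\<close>

lemma card_roots_eq_degree:
  fixes p :: "'a::alg_closed_field poly"
  assumes "p \<noteq> 0" and "\<And>x. poly p x = 0 \<Longrightarrow> poly (pderiv p) x \<noteq> 0"
  shows "card {x. poly p x = 0} = degree p"
  using assms
proof (induction "degree p" arbitrary: p)
  case 0
  then obtain c where "p = [:c:]" using degree_eq_zeroE by metis
  thus ?case using 0 by simp
next
  case (Suc n)
  then obtain x where x: "poly p x = 0" using alg_closed_imp_poly_has_root[of p] by auto
  then obtain q where q: "p = [:- x, 1:] * q" by (auto simp: poly_eq_0_iff_dvd)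
  have q0: "q \<noteq> 0" using Suc.prems q by auto
  have deg: "degree p = Suc (degree q)" unfolding q using q0 by (subst degree_mult_eq) auto
  have der: "poly (pderiv p) y = poly q y + (y - x) * poly (pderiv q) y" for y
    unfolding q by (simp only: pderiv_mult) (simp add: pderiv_pCons algebra_simps)
  have qx: "poly q x \<noteq> 0" using Suc.prems(2)[OF x] by (simp add: der)
  have "card {y. poly q y = 0} = degree q"
  proof (rule Suc.hyps(1)[OF _ q0])
    show "n = degree q" using Suc.hyps(2) deg by simp
    show "poly (pderiv q) y \<noteq> 0" if "poly q y = 0" for y
    proof -
      have "poly p y = 0" using that by (simp add: q)
      from Suc.prems(2)[OF this] show ?thesis using that by (auto simp: der)
    qed
  qed
  moreover have "{y. poly p y = 0} = insert x {y. poly q y = 0}" by (auto simp: q)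
  moreover have "finite {y. poly q y = 0}" using q0 by (rule poly_roots_finite)
  ultimately show ?case using qx deg by simp
qed

lemma order_gt_1I:
  fixes p :: "'a::field poly"
  assumes "p \<noteq> 0" "poly p x = 0" "poly (pderiv p) x = 0"
  shows "order x p > 1"
proof -
  obtain q where q: "p = [:- x, 1:] * q" using assms(2) by (auto simp: poly_eq_0_iff_dvd)
  have "poly (pderiv p) x = poly q x"
    unfolding q by (simp only: pderiv_mult) (simp add: pderiv_pCons)
  then obtain r where "q = [:- x, 1:] * r" using assms(3) by (auto simp: poly_eq_0_iff_dvd)
  hence "p = [:- x, 1:] ^ 2 * r" unfolding q by (simp only: power2_eq_square mult.assoc)
  hence "[:- x, 1:] ^ 2 dvd p" by (rule dvdI)
  thus ?thesis using assms(1) order_divides[of x 2 p] by simp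
qed

lemma poly_cubic_conv:
  fixes p :: "'a::zero poly"
  assumes "degree p \<le> 3"
  shows "p = [:coeff p 0, coeff p 1, coeff p 2, coeff p 3:]"
  using assms by (intro poly_eqI) (auto simp: coeff_pCons coeff_eq_0 numeral_eq_Suc split: nat.splits)

section \<open>Passage to the algebraic closure, proportional vectors and coprime pairs\<close>

lemma map_poly_to_ac_add: "map_poly to_ac (p + q) = map_poly to_ac p + map_poly to_ac q"
  by (rule poly_eqI) (simp add: coeff_map_poly)

lemma map_poly_to_ac_mult: "map_poly to_ac (p * q) = map_poly to_ac p * map_poly to_ac q"
  by (rule poly_eqI) (simp add: coeff_map_poly coeff_mult to_ac_sum)

text \<open>Both (p1, q1) and (p2, q2) are orthogonal to the nonzero vector (h, -g), hence
  proportional.\<close>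

lemma cross_mult_eq:
  fixes g h :: "'a::idom"
  assumes "p1 * h = q1 * g" "p2 * h = q2 * g" "g \<noteq> 0 \<or> h \<noteq> 0"
  shows "p1 * q2 = p2 * q1"
proof -
  have "(p1 * q2) * h = q2 * (p1 * h)" "(p1 * q2) * g = p1 * (q2 * g)" by (simp_all only: mult_ac)
  moreover have "q2 * (p1 * h) = q1 * (p2 * h)" unfolding assms(1,2) by (simp only: mult_ac)
  moreover have "p1 * (q2 * g) = p2 * (q1 * g)" unfolding assms(1,2)[symmetric] by (simp only: mult_ac)
  ultimately have "(p1 * q2) * h = (p2 * q1) * h" "(p1 * q2) * g = (p2 * q1) * g" by (simp_all only: mult_ac)
  thus ?thesis using assms(3) by auto
qed

lemma map_poly_to_ac_1: "map_poly to_ac 1 = 1"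
  by (simp add: one_pCons map_poly_pCons)

lemma coprime_no_common_root:
  fixes g h :: "'a::field poly"
  assumes "coprime g h"
  shows "poly g x \<noteq> 0 \<or> poly h x \<noteq> 0"
proof -
  obtain s t where "s * g + t * h = 1" using coprime_bezout_poly[OF assms] by blast
  hence "poly s x * poly g x + poly t x * poly h x = 1" by (metis poly_1 poly_add poly_mult)
  thus ?thesis by auto
qed

text \<open>A linear relation makes one polynomial zero or each a divisor of the other; by
  coprimality both are then constant.\<close>

lemma combination_neq_0:
  fixes g h :: "'a::field poly"
  assumes cop: "coprime g h" and deg: "degree g > 0 \<or> degree h > 0" and nz: "l \<noteq> 0 \<or> m \<noteq> 0"
  shows "smult l g + smult m h \<noteq> 0"
proof
  assume "smult l g + smult m h = 0"
  hence eq: "smult l g = smult (- m) h" by (simp add: eq_neg_iff_add_eq_0)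
  have "h dvd smult l g" unfolding eq by (simp add: dvd_smult)
  hence "h dvd g" if "l \<noteq> 0" using that by (simp add: dvd_smult_iff)
  moreover have "g dvd smult (- m) h" unfolding eq[symmetric] by (simp add: dvd_smult)
  hence "g dvd h" if "m \<noteq> 0" using that by (simp add: dvd_smult_iff del: smult_minus_left)
  moreover have "g = 0" if "l \<noteq> 0" "m = 0" using that eq by simp
  moreover have "h = 0" if "l = 0" "m \<noteq> 0" using that eq by simp
  ultimately have "is_unit g \<or> g = 0" "is_unit h \<or> h = 0"
    using nz cop by (metis coprime_common_divisor dvd_refl)+
  moreover have "degree p = 0" if "is_unit p \<or> p = 0" for p :: "'a poly"
    using that by (cases "p = 0") (auto simp: is_unit_iff_degree)
  ultimately show False using deg by auto
qed

subsection \<open>Ramification of cubic expressions in characteristic three\<close>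

locale cubic_char_3 =
  fixes R :: "'a::field poly fract"
  assumes char_3: "CHAR('a) = 3" and deg: "rat_degree R = 3"
begin

abbreviation "G \<equiv> rat_num_ac R"
abbreviation "H \<equiv> rat_denom_ac R"
definition a where "a i = coeff (rat_num R) i"
definition b where "b i = coeff (rat_denom R) i"
definition "W = pderiv G * H - G * pderiv H"

lemma rat_num_conv: "rat_num R = [:a 0, a 1, a 2, a 3:]"
  unfolding a_def using deg by (intro poly_cubic_conv) (simp add: rat_degree_def)

lemma rat_denom_conv: "rat_denom R = [:b 0, b 1, b 2, b 3:]"
  unfolding b_def using deg by (intro poly_cubic_conv) (simp add: rat_degree_def)

lemma lead_neq_0: "a 3 \<noteq> 0 \<or> b 3 \<noteq> 0"
  using deg leading_coeff_0_iff[of "rat_num R"] leading_coeff_0_iff[of "rat_denom R"]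
  unfolding a_def b_def rat_degree_def by (metis degree_0 max_def zero_neq_numeral)

lemma G_conv: "G = [:to_ac (a 0), to_ac (a 1), to_ac (a 2), to_ac (a 3):]"
  by (simp add: rat_num_ac_def rat_num_conv map_poly_pCons)

lemma H_conv: "H = [:to_ac (b 0), to_ac (b 1), to_ac (b 2), to_ac (b 3):]"
  by (simp add: rat_denom_ac_def rat_denom_conv map_poly_pCons)

lemma three_eq_0: "(3 :: 'a) = 0"
  using of_nat_CHAR[where 'a = 'a] by (simp add: char_3)

lemma three_eq_0_ac: "(3 :: 'a alg_closure) = 0"
  using three_eq_0 by (metis to_ac_0 to_ac_numeral)

lemma two_eq_ac: "(2 :: 'a alg_closure) = - 1"
  using three_eq_0_ac by (simp add: eq_neg_iff_add_eq_0)

text \<open>The cubic term has derivative 0 and 2 = -1, so both derivatives are linear.\<close>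

lemma pderiv_G: "pderiv G = [:to_ac (a 1), - to_ac (a 2):]"
  and pderiv_H: "pderiv H = [:to_ac (b 1), - to_ac (b 2):]"
  unfolding G_conv H_conv by (simp_all add: pderiv_pCons three_eq_0_ac two_eq_ac)

text \<open>A Bezout identity over the ground field remains one over the closure.\<close>

lemma coprime_ac: "coprime G H"
proof -
  obtain s t where "s * rat_num R + t * rat_denom R = 1"
    using coprime_bezout_poly[OF rat_quot_props(2)] by blast
  hence "map_poly to_ac s * G + map_poly to_ac t * H = 1"
    by (simp add: rat_num_ac_def rat_denom_ac_def map_poly_to_ac_1
          flip: map_poly_to_ac_add map_poly_to_ac_mult)
  thus ?thesis by (intro coprimeI) (metis dvd_add dvd_mult)
qed

lemma degree_ac: "degree G > 0 \<or> degree H > 0"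
  using lead_neq_0 by (auto simp: G_conv H_conv)

lemma no_common_root: "poly G x \<noteq> 0 \<or> poly H x \<noteq> 0"
  by (rule coprime_no_common_root[OF coprime_ac])

section \<open>The Wronskian and its zeros as ramification points\<close>

lemma poly_W: "poly W x = poly (pderiv G) x * poly H x - poly G x * poly (pderiv H) x"
  by (simp add: W_def)

text \<open>For c = G(x) / H(x) the fibre polynomial G - c H has derivative W(x) / H(x) at x. At a
  pole W(x) = - G(x) H'(x) with G(x) nonzero, so x is a multiple zero of H.\<close>

lemma ramified_finite:
  assumes "poly W x = 0"
  shows "Some x \<in> ramification_points R"
proof (cases "poly H x = 0")
  case True
  hence G: "poly G x \<noteq> 0" using no_common_root by blast
  hence "poly (pderiv H) x = 0" using assms True by (simp add: poly_W)
  moreover have "H \<noteq> 0" using rat_quot_props(3)[of R] by (auto simp: rat_denom_ac_def map_poly_eq_0_iff)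
  ultimately have "order x H > 1" using True by (intro order_gt_1I)
  thus ?thesis using True by (simp add: ramification_points_def ramification_index_def)
next
  case False
  define c where "c = poly G x / poly H x"
  let ?f = "G - smult c H"
  have "poly ?f x = 0" using False by (simp add: c_def)
  moreover have "poly (pderiv ?f) x = 0" using assms False
    by (simp add: c_def pderiv_diff pderiv_smult poly_W field_simps)
  moreover have "?f \<noteq> 0"
    using combination_neq_0[OF coprime_ac degree_ac, of 1 "- c"] by simp
  ultimately have "order x ?f > 1" by (intro order_gt_1I)
  thus ?thesis using False by (simp add: ramification_points_def ramification_index_def c_def)
qed

text \<open>The hypothesis says that the degree 4 coefficient of \<open>W\<close> vanishes. The
  polynomial of the fibre through infinity then loses its terms of degree 3 and 2 together, so
  infinity has multiplicity at least 2.\<close>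

lemma ramified_infinity:
  assumes "a 2 * b 3 = a 3 * b 2"
  shows "None \<in> ramification_points R"
proof (cases "b 3 = 0")
  case True
  hence "b 2 = 0" using assms lead_neq_0 by auto
  hence "degree H \<le> 1" using True by (simp add: H_conv)
  moreover have "coeff H 3 = 0" using True by (simp add: H_conv numeral_eq_Suc)
  ultimately show ?thesis by (simp add: ramification_points_def ramification_index_def deg)
next
  case False
  hence "coeff H 3 \<noteq> 0" by (simp add: H_conv numeral_eq_Suc)
  moreover have "degree (G - smult (to_ac (a 3) / to_ac (b 3)) H) \<le> 1"
  proof -
    have "to_ac (a 2) * to_ac (b 3) = to_ac (a 3) * to_ac (b 2)" using assms by (metis to_ac_mult)
    thus ?thesis using False by (simp add: G_conv H_conv field_simps)
  qed
  moreover have "coeff G 3 = to_ac (a 3)" "coeff H 3 = to_ac (b 3)"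
    by (simp_all add: G_conv H_conv numeral_eq_Suc)
  ultimately show ?thesis by (simp add: ramification_points_def ramification_index_def deg Let_def)
qed

lemma W_conv:
  "W = [:to_ac (a 1 * b 0 - a 0 * b 1), to_ac (a 0 * b 2 - a 2 * b 0),
   to_ac (a 2 * b 1 - a 1 * b 2), to_ac (a 1 * b 3 - a 3 * b 1), to_ac (a 3 * b 2 - a 2 * b 3):]"
proof -
  \<comment> \<open>The middle coefficient first comes out as twice
    \<open>a 1 * b 2 - a 2 * b 1\<close>; doubling is negation here.\<close>
  have "y + y = - y" for y :: "'a alg_closure"
    using two_eq_ac by (metis mult_2 mult_minus1)
  from this[of "to_ac (a 1) * to_ac (b 2) - to_ac (a 2) * to_ac (b 1)"]
  have e: "to_ac (a 1) * to_ac (b 2) - to_ac (a 2) * to_ac (b 1)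
      - (to_ac (a 2) * to_ac (b 1) - to_ac (a 1) * to_ac (b 2))
      = to_ac (a 2) * to_ac (b 1) - to_ac (a 1) * to_ac (b 2)" by simp
  show ?thesis
    unfolding W_def pderiv_G pderiv_H unfolding G_conv H_conv
    by (simp add: e three_eq_0_ac)
qed

text \<open>
  At a double zero \<open>x\<close> of \<open>W\<close> the first two derivatives of \<open>H(x) G - G(x) H\<close> vanish, so this
  cubic has no terms of degree 1 and 2.
\<close>
lemma W_double_root:
  assumes "poly W x = 0" "poly (pderiv W) x = 0"
  shows "a 1 * b 2 = a 2 * b 1"
proof -
  let ?a = "\<lambda>i. to_ac (a i)" and ?b = "\<lambda>i. to_ac (b i)"
  define g h where "g = poly G x" and "h = poly H x"
  have "pderiv W = pderiv (pderiv G) * H - G * pderiv (pderiv H)"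
    by (simp add: W_def pderiv_diff pderiv_mult)
  hence "poly (pderiv W) x = - ?a 2 * h + ?b 2 * g"
    by (simp add: pderiv_G pderiv_H pderiv_pCons g_def h_def)
  hence 2: "?a 2 * h = ?b 2 * g" using assms(2) by simp
  have "(?a 1 - x * ?a 2) * h = g * (?b 1 - x * ?b 2)"
    using assms(1) by (simp add: poly_W pderiv_G pderiv_H g_def h_def)
  hence "?a 1 * h - x * (?a 2 * h) = ?b 1 * g - x * (?b 2 * g)" by (simp only: algebra_simps)
  hence 1: "?a 1 * h = ?b 1 * g" unfolding 2 by simp
  have "?a 1 * ?b 2 = ?a 2 * ?b 1"
    by (rule cross_mult_eq[OF 1 2]) (use no_common_root[of x] in \<open>simp add: g_def h_def\<close>)
  thus ?thesis by (metis to_ac_mult to_ac_eq_iff)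
qed

lemma W_eq_0_imp_infinite:
  assumes "W = 0" shows "infinite (ramification_points R)"
proof -
  have "range Some \<subseteq> ramification_points R" using ramified_finite assms by auto
  moreover have "infinite (range (Some :: 'a alg_closure \<Rightarrow> _))"
    using infinite_UNIV_alg_closed by (simp add: finite_image_iff)
  ultimately show ?thesis using finite_subset by blast
qed

text \<open>Otherwise all zeros of \<open>W\<close> are simple, and counting infinity where needed
  gives four ramification points.\<close>

lemma few_ramification_points:
  assumes fin: "finite (ramification_points R)" and card: "card (ramification_points R) \<le> 3"
  shows "a 1 * b 2 = a 2 * b 1"
proof (rule ccontr)
  assume e: "a 1 * b 2 \<noteq> a 2 * b 1"
  have W0: "W \<noteq> 0" using W_eq_0_imp_infinite fin by blast
  have roots: "card {x. poly W x = 0} = degree W"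
    by (rule card_roots_eq_degree[OF W0]) (use W_double_root e in blast)
  have cardS: "card (Some ` {x. poly W x = 0}) = degree W"
    using roots by (simp add: card_image)
  have sub: "Some ` {x. poly W x = 0} \<subseteq> ramification_points R" using ramified_finite by auto
  show False
  proof (cases "a 3 * b 2 = a 2 * b 3")
    case False
    hence "to_ac (a 3 * b 2 - a 2 * b 3) \<noteq> 0" by (simp del: to_ac_mult to_ac_diff)
    hence "degree W = 4" by (simp add: W_conv del: to_ac_mult to_ac_diff)
    thus False using card_mono[OF fin sub] cardS card by simp
  next
    case True
    \<comment> \<open>Infinity is only a simple zero: otherwise the index 1 and index 2 coefficient
      pairs would both be proportional to the nonzero pair (\<open>a 3\<close>, \<open>b 3\<close>),
      hence to each other.\<close>
    have "a 1 * b 3 \<noteq> a 3 * b 1"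
    proof
      assume *: "a 1 * b 3 = a 3 * b 1"
      have "a 1 * b 2 = a 2 * b 1"
        by (rule cross_mult_eq[of _ "b 3" _ "a 3"]) (use * True lead_neq_0 in \<open>simp_all add: mult_ac\<close>)
      thus False using e by simp
    qed
    hence "to_ac (a 1 * b 3 - a 3 * b 1) \<noteq> 0" by (simp del: to_ac_mult to_ac_diff)
    hence "degree W = 3" using True by (simp add: W_conv del: to_ac_mult to_ac_diff)
    moreover have "insert None (Some ` {x. poly W x = 0}) \<subseteq> ramification_points R"
      using sub ramified_infinity True by auto
    from card_mono[OF fin this] have "card (insert None (Some ` {x. poly W x = 0})) \<le> 3"
      using card by linarith
    moreover have "finite {x. poly W x = 0}" using W0 by (rule poly_roots_finite)
    ultimately show False using cardS by (subst (asm) card_insert_disjoint) auto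
  qed
qed

text \<open>The inseparable case: \<open>R\<close> is an expression in the cube of the
  variable.\<close>

lemma all_coeffs_zero_imp_infinite:
  assumes "a 1 = 0" "a 2 = 0" "b 1 = 0" "b 2 = 0"
  shows "infinite (ramification_points R)"
proof (rule W_eq_0_imp_infinite)
  show "W = 0" by (simp add: W_def pderiv_G pderiv_H assms del: One_nat_def)
qed

end

subsection \<open>Normal forms\<close>

lemma add_cubed_char_3:
  fixes x y :: "'a::comm_ring_1"
  assumes "(3 :: 'a) = 0"
  shows "(x + y) ^ 3 = x ^ 3 + y ^ 3"
proof -
  have "(x + y) ^ 3 = x ^ 3 + y ^ 3 + 3 * (x\<^sup>2 * y + x * y\<^sup>2)"
    by (simp add: power3_eq_cube power2_eq_square algebra_simps)
  thus ?thesis by (simp add: assms)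
qed

text \<open>Cubing is additive, so it has trivial kernel and is injective; finiteness makes it
  surjective.\<close>

lemma cube_root_exists:
  fixes x :: "'a::{field,finite}"
  assumes "(3 :: 'a) = 0"
  obtains y where "y ^ 3 = x"
proof -
  have "inj (\<lambda>y :: 'a. y ^ 3)"
  proof (rule injI)
    fix y z :: 'a assume "y ^ 3 = z ^ 3"
    moreover have "y ^ 3 = (y - z) ^ 3 + z ^ 3"
      using add_cubed_char_3[OF assms, of "y - z" z] by simp
    ultimately show "y = z" by simp
  qed
  hence "surj (\<lambda>y :: 'a. y ^ 3)" by (rule finite_UNIV_inj_surj[OF finite_class.finite_UNIV])
  thus ?thesis using that by (metis surjD)
qed

text \<open>Squaring is at most two-to-one, so squares make up at least half of the nonzero
  elements. Their multiples by \<sigma> form a disjoint set of the same size, and the two sets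
  exhaust the rest.\<close>

lemma square_or_nonsquare_multiple:
  fixes \<sigma> r :: "'a::{field,finite}"
  assumes \<sigma>: "\<nexists>y. \<sigma> = y ^ 2" and r: "r \<noteq> 0"
  obtains y where "y \<noteq> 0" "r = y ^ 2 \<or> r = \<sigma> * y ^ 2"
proof -
  define U Q where "U = (UNIV - {0} :: 'a set)" and "Q = (\<lambda>y :: 'a. y ^ 2) ` U"
  have \<sigma>0: "\<sigma> \<noteq> 0" using \<sigma> by (metis zero_power2)
  have fibre: "card {y. y ^ 2 = s} \<le> 2" for s :: 'a
  proof (cases "\<exists>y. y ^ 2 = s")
    case True
    then obtain y where "y ^ 2 = s" by blast
    hence "{y. y ^ 2 = s} \<subseteq> {y, - y}" by (auto simp: power2_eq_iff)
    hence "card {y. y ^ 2 = s} \<le> card {y, - y}" by (intro card_mono) auto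
    also have "\<dots> \<le> 2" by (simp add: card_insert_if)
    finally show ?thesis .
  qed simp
  have "card U \<le> card (\<Union>s\<in>Q. {y. y ^ 2 = s})" by (intro card_mono) (auto simp: Q_def)
  also have "\<dots> \<le> (\<Sum>s\<in>Q. card {y. y ^ 2 = s})" by (intro card_UN_le) simp
  also have "\<dots> \<le> card Q * 2" using sum_bounded_above[of Q "\<lambda>s. card {y. y ^ 2 = s}" 2] fibre by simp
  finally have le: "card U \<le> card Q * 2" .
  have disj: "Q \<inter> (*) \<sigma> ` Q = {}"
  proof (rule ccontr)
    assume "Q \<inter> (*) \<sigma> ` Q \<noteq> {}"
    then obtain y z where "y ^ 2 = \<sigma> * z ^ 2" "z \<noteq> 0" by (auto simp: Q_def U_def)
    hence "\<sigma> = (y / z) ^ 2" by (simp add: field_simps)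
    thus False using \<sigma> by blast
  qed
  have "card ((*) \<sigma> ` Q) = card Q" using \<sigma>0 by (intro card_image inj_onI) simp
  hence "card (Q \<union> (*) \<sigma> ` Q) = card Q * 2" using disj by (subst card_Un_disjoint) auto
  moreover have "Q \<union> (*) \<sigma> ` Q \<subseteq> U" using \<sigma>0 by (auto simp: Q_def U_def)
  ultimately have "Q \<union> (*) \<sigma> ` Q = U" using le by (intro card_seteq) auto
  hence "r \<in> Q \<union> (*) \<sigma> ` Q" using r by (simp add: U_def)
  thus ?thesis using that by (auto simp: Q_def U_def)
qed

lemma rat_X_cubic_not_const:
  "rat_X ^ 3 + rat_const c * rat_X ^ 2 + rat_const d * rat_X \<notin> range rat_const"
proof
  assume "rat_X ^ 3 + rat_const c * rat_X ^ 2 + rat_const d * rat_X \<in> range rat_const"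
  then obtain e where "rat_X ^ 3 + rat_const c * rat_X ^ 2 + rat_const d * rat_X = rat_const e" by blast
  moreover have "to_fract [:0, d, c, 1:] = rat_X ^ 3 + rat_const c * rat_X ^ 2 + rat_const d * rat_X"
    by (simp add: to_fract_pCons power3_eq_cube power2_eq_square algebra_simps)
  ultimately show False by (simp add: rat_const_def)
qed

text \<open>An affine substitution adjusts the terms of positive degree; scaling by \<open>z\<close>
  and shifting by \<open>w\<close> absorb the leading coefficient and the constant.\<close>

lemma cubic_normal_form:
  fixes \<sigma> p0 p1 p2 p3 :: "'a::{field,finite}"
  assumes three: "(3 :: 'a) = 0" and \<sigma>: "\<nexists>y. \<sigma> = y ^ 2"
    and p3: "p3 \<noteq> 0" and p12: "p1 \<noteq> 0 \<or> p2 \<noteq> 0"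
  obtains u v z w S where "u \<noteq> 0" "z \<noteq> 0"
    "S \<in> {rat_X ^ 3 + rat_X ^ 2, rat_X ^ 3 + rat_X, rat_X ^ 3 + rat_const \<sigma> * rat_X}"
    "\<And>U. U = rat_const u * rat_X + rat_const v \<Longrightarrow>
      rat_const p3 * U ^ 3 + rat_const p2 * U ^ 2 + rat_const p1 * U + rat_const p0 =
      rat_const z * S + rat_const w"
proof -
  define x where "x = (rat_X :: 'a poly fract)"
  have three': "(3 :: 'a poly fract) = 0"
    using arg_cong[OF three, of rat_const] by simp
  have expand: "rat_const p3 * U ^ 3 + rat_const p2 * U ^ 2 + rat_const p1 * U + rat_const p0 =
      rat_const (p3 * u ^ 3) * x ^ 3 + rat_const (p2 * u ^ 2) * x ^ 2 + rat_const (u * (2 * p2 * v + p1)) * x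
      + rat_const (p3 * v ^ 3 + p2 * v ^ 2 + p1 * v + p0)" if U: "U = rat_const u * x + rat_const v" for U u v
  proof -
    have "U ^ 3 = rat_const (u ^ 3) * x ^ 3 + rat_const (v ^ 3)"
      unfolding U add_cubed_char_3[OF three'] by (simp add: power_mult_distrib)
    moreover have "U ^ 2 = rat_const (u ^ 2) * x ^ 2 + rat_const (u * v + u * v) * x + rat_const (v ^ 2)"
      unfolding U by (simp add: power2_eq_square algebra_simps)
    moreover have "u * (2 * p2 * v + p1) = p2 * (u * v + u * v) + p1 * u" by (simp add: algebra_simps)
    ultimately show ?thesis unfolding U by (simp only: rat_const_add rat_const_mult) (simp add: algebra_simps)
  qed
  show ?thesis
  proof (cases "p2 = 0")
    case False
    \<comment> \<open>\<open>u\<close> equalises the coefficients of degree 3 and 2;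
      \<open>v\<close> turns the linear one into a multiple of 3.\<close>
    define u v where "u = p2 / p3" and "v = p1 / p2"
    have "u * (2 * p2 * v + p1) = u * (3 * p1)" using False by (simp add: v_def)
    hence "u * (2 * p2 * v + p1) = 0" by (simp add: three)
    moreover have "p3 * u ^ 3 = p2 * u ^ 2" using p3 by (simp add: u_def power3_eq_cube power2_eq_square)
    ultimately have "rat_const p3 * U ^ 3 + rat_const p2 * U ^ 2 + rat_const p1 * U + rat_const p0 =
        rat_const (p2 * u ^ 2) * (x ^ 3 + x ^ 2) + rat_const (p3 * v ^ 3 + p2 * v ^ 2 + p1 * v + p0)"
      if "U = rat_const u * rat_X + rat_const v" for U
      using expand[of U u v] that by (simp only: x_def rat_const_0 distrib_left mult_zero_left add_0_right)
    thus ?thesis using False p3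
      by (intro that[of u "p2 * u ^ 2" "x ^ 3 + x ^ 2" v "p3 * v ^ 3 + p2 * v ^ 2 + p1 * v + p0"])
        (auto simp: u_def x_def)
  next
    case True
    hence p1: "p1 \<noteq> 0" using p12 by simp
    obtain u where u: "u \<noteq> 0" "p1 / p3 = u ^ 2 \<or> p1 / p3 = \<sigma> * u ^ 2"
      by (rule square_or_nonsquare_multiple[OF \<sigma>, of "p1 / p3"]) (use p1 p3 in auto)
    \<comment> \<open>Scaling changes the ratio \<open>p1 / p3\<close> only by squares, so it can be
      normalised to 1 or \<sigma>.\<close>
    define \<tau> where "\<tau> = (if p1 / p3 = u ^ 2 then 1 else \<sigma>)"
    have "p1 = p3 * (p1 / p3)" using p3 by simp
    also have "p1 / p3 = \<tau> * u ^ 2" using u(2) by (auto simp: \<tau>_def)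
    finally have "p1 * u = p3 * u ^ 3 * \<tau>" by (simp add: power3_eq_cube power2_eq_square mult_ac)
    hence "u * (2 * p2 * 0 + p1) = p3 * u ^ 3 * \<tau>" by (simp add: mult.commute)
    hence "rat_const p3 * U ^ 3 + rat_const p2 * U ^ 2 + rat_const p1 * U + rat_const p0 =
        rat_const (p3 * u ^ 3) * (x ^ 3 + rat_const \<tau> * x) + rat_const p0"
      if "U = rat_const u * rat_X + rat_const 0" for U
      using expand[of U u 0] that True
      by (simp add: x_def distrib_left mult_ac)
    moreover have "x ^ 3 + rat_const \<tau> * x \<in>
        {rat_X ^ 3 + rat_X ^ 2, rat_X ^ 3 + rat_X, rat_X ^ 3 + rat_const \<sigma> * rat_X}"
      by (simp add: \<tau>_def x_def)
    ultimately show ?thesis using u(1) p3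
      by (intro that[of u "p3 * u ^ 3" "x ^ 3 + rat_const \<tau> * x" 0 p0]) auto
  qed
qed

section \<open>Assembling the equivalence from two combinations of numerator and denominator\<close>

lemma rat_equivalent_combinationI:
  fixes R S :: "'a::field poly fract"
  assumes detC: "p * s - q * r \<noteq> 0" and det: "l' * m - m' * l \<noteq> 0"
    and S: "S \<notin> range rat_const"
    and gC: "g = poly (map_poly rat_const (rat_num R)) (moebius p q r s)"
    and hC: "h = poly (map_poly rat_const (rat_denom R)) (moebius p q r s)"
    and eq: "rat_const l * g + rat_const m * h = rat_const k * V"
    and eq': "rat_const l' * g + rat_const m' * h = (rat_const z * S + rat_const w) * V"
    and ne: "V \<noteq> 0" "k \<noteq> 0" "z \<noteq> 0"
  shows "rat_equivalent R S"
proof -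
  \<comment> \<open>The quotient of \<open>eq'\<close> by \<open>eq\<close> is (z S + w) / k.
    Solving for \<open>S\<close> multiplies the matrix with rows (l', m') and (l, m) by the one with
    rows (k, -w) and (0, z).\<close>
  have L: "rat_const (k * l' - w * l) * g + rat_const (k * m' - w * m) * h = rat_const (k * z) * S * V"
  proof -
    have "rat_const (k * l' - w * l) * g + rat_const (k * m' - w * m) * h =
       rat_const k * (rat_const l' * g + rat_const m' * h) - rat_const w * (rat_const l * g + rat_const m * h)"
      by (simp add: algebra_simps)
    thus ?thesis unfolding eq eq' by (simp add: algebra_simps)
  qed
  have M: "rat_const (z * l) * g + rat_const (z * m) * h = rat_const (k * z) * V"
  proof -
    have "rat_const (z * l) * g + rat_const (z * m) * h = rat_const z * (rat_const l * g + rat_const m * h)"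
      by (simp add: algebra_simps)
    thus ?thesis unfolding eq by (simp add: algebra_simps)
  qed
  have "(k * l' - w * l) * (z * m) - (k * m' - w * m) * (z * l) = k * z * (l' * m - m' * l)"
    by (simp add: algebra_simps)
  hence "(k * l' - w * l) * (z * m) - (k * m' - w * m) * (z * l) \<noteq> 0"
    using det ne by (simp only: mult_eq_0_iff) simp
  thus ?thesis
    by (rule rat_equivalentI[OF detC _ S gC hC]) (use ne in \<open>simp_all only: L M, simp_all\<close>)
qed

theorem theorem7p1:
  fixes \<sigma> :: "'a::{field,finite}" and R :: "'a poly fract"
  assumes "CHAR('a) = 3"
    and "\<nexists>y. \<sigma> = y ^ 2"
    and "rat_degree R = 3"
    and "finite (ramification_points R)" and "card (ramification_points R) \<le> 3"
  shows "rat_equivalent R (rat_X ^ 3 + rat_X ^ 2) \<or>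
         rat_equivalent R (rat_X ^ 3 + rat_X) \<or>
         rat_equivalent R (rat_X ^ 3 + rat_const \<sigma> * rat_X)"
proof -
  interpret cubic_char_3 R using assms(1,3) by unfold_locales
  note three = three_eq_0
  have "a 1 * b 2 = a 2 * b 1" using few_ramification_points assms(4,5) .
  then obtain l m where lm: "l \<noteq> 0 \<or> m \<noteq> 0" "l * a 1 + m * b 1 = 0" "l * a 2 + m * b 2 = 0"
  proof (cases "b 1 = 0 \<and> a 1 = 0")
    case True
    thus ?thesis
      \<comment> \<open>The pair (\<open>b 2\<close>, \<open>- a 2\<close>) serves unless it is
        zero; then all four coefficients vanish and (0, 1) will do.\<close>
      using that[of "b 2" "if b 2 = 0 \<and> a 2 = 0 then 1 else - a 2"] by (auto simp: mult_ac)
  next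
    case False
    thus ?thesis using that[of "b 1" "- a 1"] \<open>a 1 * b 2 = a 2 * b 1\<close> by (auto simp: mult_ac)
  qed
  \<comment> \<open>A second combination, independent of the first.\<close>
  define l' m' where "l' = (if l = 0 then 1 else 0 :: 'a)" and "m' = (if l = 0 then 0 else 1 :: 'a)"
  have det: "l' * m - m' * l \<noteq> 0" using lm(1) by (auto simp: l'_def m'_def)
  define c d where "c i = l * a i + m * b i" and "d i = l' * a i + m' * b i" for i
  have c12: "c 1 = 0" "c 2 = 0" using lm by (simp_all add: c_def)
  have both_0: "x = 0 \<and> y = 0" if "l * x + m * y = 0" "l' * x + m' * y = 0" for x y
    using that lm(1) by (auto simp: l'_def m'_def split: if_splits)
  \<comment> \<open>Otherwise \<open>R\<close> would be inseparable, with infinitely many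
    ramification points.\<close>
  have d12: "d 2 \<noteq> 0 \<or> d 1 \<noteq> 0"
    using both_0[of "a 1" "b 1"] both_0[of "a 2" "b 2"] c12 all_coeffs_zero_imp_infinite assms(4)
    unfolding c_def d_def by blast
  have c03: "c 0 \<noteq> 0 \<or> c 3 \<noteq> 0"
  proof -
    have "degree (rat_num R) > 0 \<or> degree (rat_denom R) > 0" using deg by (auto simp: rat_degree_def)
    from combination_neq_0[OF rat_quot_props(2) this lm(1)] show ?thesis
      using c12 unfolding rat_num_conv rat_denom_conv by (auto simp: c_def)
  qed
  define ev where "ev e C =
      rat_const (e 0) + rat_const (e 1) * C + rat_const (e 2) * C ^ 2 + rat_const (e 3) * C ^ 3"
    for e :: "nat \<Rightarrow> 'a" and C
  have gev: "poly (map_poly rat_const (rat_num R)) C = ev a C"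
    and hev: "poly (map_poly rat_const (rat_denom R)) C = ev b C" for C
    unfolding rat_num_conv rat_denom_conv ev_def
    by (simp_all add: map_poly_pCons power2_eq_square power3_eq_cube algebra_simps)
  have cev: "rat_const l * ev a C + rat_const m * ev b C = ev c C"
    and dev: "rat_const l' * ev a C + rat_const m' * ev b C = ev d C" for C
    by (simp_all add: c_def d_def ev_def algebra_simps)
  have concl: ?thesis
    if "S \<in> {rat_X ^ 3 + rat_X ^ 2, rat_X ^ 3 + rat_X, rat_X ^ 3 + rat_const \<sigma> * rat_X}"
      "p * s - q * r \<noteq> 0" "ev c (moebius p q r s) = rat_const k * V"
      "ev d (moebius p q r s) = (rat_const z * S + rat_const w) * V"
      "V \<noteq> 0" "k \<noteq> 0" "z \<noteq> 0" for S p q r s k z w V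
  proof -
    have "S \<notin> range rat_const"
      using that(1) rat_X_cubic_not_const[of 1 0] rat_X_cubic_not_const[of 0 1]
        rat_X_cubic_not_const[of 0 \<sigma>] by (elim insertE emptyE) simp_all
    hence "rat_equivalent R S"
      by (rule rat_equivalent_combinationI[OF that(2) det _ gev[symmetric] hev[symmetric] _ _ that(5-7), where w = w])
         (simp_all only: cev dev that(3,4))
    thus ?thesis using that(1) by auto
  qed
  show ?thesis
  proof (cases "c 3 = 0")
    case True
    \<comment> \<open>The first combination is the constant \<open>c 0\<close>, so infinity already
      has index 3 and the second one is a cubic polynomial.\<close>
    have "d 3 \<noteq> 0" using both_0[of "a 3" "b 3"] True lead_neq_0 by (auto simp: c_def d_def)
    then obtain u v z w S where uv: "u \<noteq> 0" "z \<noteq> 0"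
      "S \<in> {rat_X ^ 3 + rat_X ^ 2, rat_X ^ 3 + rat_X, rat_X ^ 3 + rat_const \<sigma> * rat_X}"
      "\<And>U. U = rat_const u * rat_X + rat_const v \<Longrightarrow>
        rat_const (d 3) * U ^ 3 + rat_const (d 2) * U ^ 2 + rat_const (d 1) * U + rat_const (d 0) =
        rat_const z * S + rat_const w"
      using cubic_normal_form[OF three assms(2), of "d 3" "d 1" "d 2" "d 0"] d12 by metis
    define U where "U = rat_const u * rat_X + rat_const v"
    have C: "moebius u v 0 1 = U" by (subst moebius_conv) (simp_all add: U_def)
    show ?thesis
    proof (rule concl[OF uv(3), of u 1 v 0 "c 0" 1 z w])
      show "ev d (moebius u v 0 1) = (rat_const z * S + rat_const w) * 1"
        unfolding C using uv(4)[OF U_def] by (simp add: ev_def algebra_simps)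
    qed (use True c12 c03 uv in \<open>auto simp: ev_def\<close>)
  next
    case False
    \<comment> \<open>\<open>t\<close> is the point of ramification index 3; \<open>C = t + 1 / U\<close> moves it to infinity.\<close>
    obtain t where t: "t ^ 3 = - c 0 / c 3" by (rule cube_root_exists[OF three])
    have ct: "c 0 = - c 3 * t ^ 3" using False by (simp add: t)
    \<comment> \<open>Expanding d(t + 1 / U) U^3 in powers of U gives the coefficients
      \<open>p3\<close> = d(t), \<open>p2\<close> = d'(t), \<open>d 2\<close> and
      \<open>d 3\<close>; the remaining terms are multiples of 3.\<close>
    define p3 where "p3 = d 0 + d 1 * t + d 2 * t ^ 2 + d 3 * t ^ 3"
    define p2 where "p2 = d 1 + 2 * d 2 * t"
    \<comment> \<open>The first combination vanishes at \<open>t\<close>; if the second did too,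
      numerator and denominator would share a root.\<close>
    have "p3 \<noteq> 0"
    proof
      assume "p3 = 0"
      have P: "poly (rat_num R) t = a 0 + a 1 * t + a 2 * t ^ 2 + a 3 * t ^ 3"
        "poly (rat_denom R) t = b 0 + b 1 * t + b 2 * t ^ 2 + b 3 * t ^ 3"
        unfolding rat_num_conv rat_denom_conv
        by (simp_all add: power2_eq_square power3_eq_cube algebra_simps)
      have "l * poly (rat_num R) t + m * poly (rat_denom R) t = c 0 + c 1 * t + c 2 * t ^ 2 + c 3 * t ^ 3"
        "l' * poly (rat_num R) t + m' * poly (rat_denom R) t = p3"
        by (simp_all add: P c_def d_def p3_def algebra_simps)
      hence "poly (rat_num R) t = 0 \<and> poly (rat_denom R) t = 0"
        using \<open>p3 = 0\<close> c12 ct by (intro both_0) simp_all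
      thus False using coprime_no_common_root[OF rat_quot_props(2)[of R]] by blast
    qed
    moreover have "d 2 \<noteq> 0 \<or> p2 \<noteq> 0" using d12 by (auto simp: p2_def)
    ultimately obtain u v z w S where uv: "u \<noteq> 0" "z \<noteq> 0"
      "S \<in> {rat_X ^ 3 + rat_X ^ 2, rat_X ^ 3 + rat_X, rat_X ^ 3 + rat_const \<sigma> * rat_X}"
      "\<And>U. U = rat_const u * rat_X + rat_const v \<Longrightarrow>
        rat_const p3 * U ^ 3 + rat_const p2 * U ^ 2 + rat_const (d 2) * U + rat_const (d 3) =
        rat_const z * S + rat_const w"
      using cubic_normal_form[OF three assms(2), of p3 "d 2" p2 "d 3"] by metis
    define U where "U = rat_const u * rat_X + rat_const v"
    have U: "U \<noteq> 0" unfolding U_def using uv(1) by (intro linear_rat_X_neq_0) simp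
    define C where "C = rat_const t + 1 / U"
    have "moebius (t * u) (t * v + 1) u v = (rat_const t * U + 1) / U"
      using uv(1) by (subst moebius_conv) (simp_all add: U_def algebra_simps)
    hence C: "moebius (t * u) (t * v + 1) u v = C" using U by (simp add: C_def add_divide_distrib)
    have three': "(3 :: 'a poly fract) = 0"
      using arg_cong[OF three, of rat_const] by simp
    have C3: "C ^ 3 = rat_const t ^ 3 + 1 / U ^ 3"
      unfolding C_def add_cubed_char_3[OF three'] by (simp add: power_divide)
    show ?thesis
    \<comment> \<open>The common factor \<open>1 / U ^ 3\<close> comes from the first combination,
      whose value at \<open>C\<close> is c(t) + c3 / U^3 with c(t) = 0.\<close>
    proof (rule concl[OF uv(3), of "t * u" v "t * v + 1" u "c 3" "1 / U ^ 3" z w])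
      show "ev c (moebius (t * u) (t * v + 1) u v) = rat_const (c 3) * (1 / U ^ 3)"
        unfolding C ev_def C3 by (simp add: c12 ct algebra_simps del: One_nat_def)
      have "ev d C * U ^ 3 =
          rat_const p3 * U ^ 3 + rat_const p2 * U ^ 2 + rat_const (d 2) * U + rat_const (d 3)"
      proof -
        have "C * U = rat_const t * U + 1" using U by (simp add: C_def algebra_simps)
        moreover have "C ^ 3 * U ^ 3 = rat_const t ^ 3 * U ^ 3 + 1"
          using U unfolding C3 by (simp add: algebra_simps)
        moreover have "ev d C * U ^ 3 = rat_const (d 0) * U ^ 3 + rat_const (d 1) * U ^ 2 * (C * U)
           + rat_const (d 2) * U * (C * U) ^ 2 + rat_const (d 3) * (C ^ 3 * U ^ 3)"
          by (simp add: ev_def power2_eq_square power3_eq_cube algebra_simps)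
        moreover have "rat_const p2 = rat_const (d 1) + 2 * (rat_const (d 2) * rat_const t)"
          by (simp add: p2_def)
        ultimately show ?thesis by (simp add: p3_def power2_eq_square power3_eq_cube algebra_simps)
      qed
      hence "ev d C * U ^ 3 = rat_const z * S + rat_const w" using uv(4)[OF U_def] by simp
      thus "ev d (moebius (t * u) (t * v + 1) u v) = (rat_const z * S + rat_const w) * (1 / U ^ 3)"
        unfolding C using U by (simp add: field_simps)
    qed (use uv U False in \<open>auto simp: algebra_simps\<close>)
  qed
qed

end
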